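(* For every integer $k\ge 1$, the energy of the wine glass path $W\!gp_k$ equals $$\mathcal{E}(W\!gp_k)=2k-2\sum_{j=1}^{k}\alpha\!\left(2\cos\frac{j\pi}{k+1}\right)-2\sum_{j=1}^{k}\beta\!\left(2\cos\frac{j\pi}{k+1}\right).$$
   Context: The energy $\mathcal{E}(G)$ of a graph $G$ is the sum of the absolute values of the eigenvalues of its adjacency matrix. For $k\ge1$, the wine glass path $W\!gp_k$ is the graph with $5k+1$ vertices $p_0,\dots,p_k$ and $q_j,r_j,s_j,t_j$ ($0\le j\le k-1$), and edges $p_jq_j$, $q_jp_{j+1}$, $q_jr_j$, $r_js_j$, $r_jt_j$, $s_jt_j$ for $0\le j\le k-1$. Let $\mathcal{F}(x)=x^2-3-\frac{2}{(x+1)(x-2)}$ for $x\in\mathbb{R}\setminus\{-1,2\}$. For each $y\in[-2,2]$ the equation $\mathcal{F}(x)=y$ has exactly four distinct real solutions, one in each of $(-\infty,-1)$, $(-1,0]$, $(0,2)$, $(2,+\infty)$; the ones in $(-\infty,-1)$ and $(-1,0]$ are denoted $\alpha(y)$ and $\beta(y)$ respectively. *)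

theory Defs
  imports
    Complex_Main
    "Graph_Theory.Pair_Digraph"
    "Jordan_Normal_Form.Spectral_Radius"
begin

text \<open>
  A finite simple graph is a \<open>pair_graph\<close>: each edge \<open>uv\<close> is represented by the two arcs
  \<open>(u, v)\<close> and \<open>(v, u)\<close>.
\<close>

definition vertex_enum :: "'v pair_pre_digraph \<Rightarrow> 'v list \<Rightarrow> bool" where
  "vertex_enum G vs \<longleftrightarrow> distinct vs \<and> set vs = pverts G"

definition adjacency_mat :: "'v pair_pre_digraph \<Rightarrow> 'v list \<Rightarrow> complex mat" where
  "adjacency_mat G vs = mat (length vs) (length vs)
     (\<lambda>(i, j). if (vs ! i, vs ! j) \<in> parcs G then 1 else 0)"

text \<open>
  The eigenvalues are taken over the complex numbers, so none is missed, and are counted with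
  their multiplicity as roots of the characteristic polynomial.
\<close>

definition mat_energy :: "complex mat \<Rightarrow> real" where
  "mat_energy A = (\<Sum>x\<in>spectrum A. real (order x (char_poly A)) * cmod x)"

text \<open>
  The choice of the vertex enumeration is immaterial, see \<open>graph_energy_eq\<close> below.
\<close>

definition graph_energy :: "'v pair_pre_digraph \<Rightarrow> real" where
  "graph_energy G = mat_energy (adjacency_mat G (SOME vs. vertex_enum G vs))"

lemma similar_adjacency_mat:
  assumes vs: "vertex_enum G vs" and ws: "vertex_enum G ws"
  shows "similar_mat (adjacency_mat G vs) (adjacency_mat G ws)"
proof -
  define n where "n = length vs"
  have dv: "distinct vs" and dw: "distinct ws" and st: "set vs = set ws"
    using vs ws by (auto simp: vertex_enum_def)
  have lw: "length ws = n"
    using dv dw st unfolding n_def by (metis distinct_card)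
  have lv: "length vs = n" by (simp add: n_def)
  define P :: "complex mat" where "P = mat n n (\<lambda>(i, j). if vs ! i = ws ! j then 1 else 0)"
  define Q :: "complex mat" where "Q = mat n n (\<lambda>(i, j). if ws ! i = vs ! j then 1 else 0)"
  have ex1: "\<exists>a<n. ws ! a = vs ! i" if "i < n" for i
    using that st lv lw by (metis in_set_conv_nth)
  have ex2: "\<exists>a<n. vs ! a = ws ! i" if "i < n" for i
    using that st lv lw by (metis in_set_conv_nth)
  have sum1: "(\<Sum>l = 0..<n. (if vs ! i = ws ! l then 1 else 0) * f l) = f a"
    if "i < n" "a < n" "ws ! a = vs ! i" for i a and f :: "nat \<Rightarrow> complex"
  proof -
    have "(\<Sum>l = 0..<n. (if vs ! i = ws ! l then 1 else 0) * f l) = (\<Sum>l = 0..<n. if a = l then f l else 0)"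
      using that dw lw by (intro sum.cong) (auto simp: nth_eq_iff_index_eq simp flip: that(3))
    then show ?thesis using that by simp
  qed
  have sum2: "(\<Sum>l = 0..<n. f l * (if ws ! l = vs ! i then 1 else 0)) = f a"
    if "i < n" "a < n" "ws ! a = vs ! i" for i a and f :: "nat \<Rightarrow> complex"
    unfolding sum1[OF that, of f, symmetric] by (intro sum.cong) auto
  have sum3: "(\<Sum>l = 0..<n. (if ws ! i = vs ! l then 1 else 0) * f l) = f a"
    if "i < n" "a < n" "vs ! a = ws ! i" for i a and f :: "nat \<Rightarrow> complex"
  proof -
    have "(\<Sum>l = 0..<n. (if ws ! i = vs ! l then 1 else 0) * f l) = (\<Sum>l = 0..<n. if a = l then f l else 0)"
      using that dv lv by (intro sum.cong) (auto simp: nth_eq_iff_index_eq simp flip: that(3))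
    then show ?thesis using that by simp
  qed
  have PQ: "P * Q = 1\<^sub>m n"
  proof (rule eq_matI)
    fix i j assume "i < dim_row (1\<^sub>m n :: complex mat)" "j < dim_col (1\<^sub>m n :: complex mat)"
    then have ij: "i < n" "j < n" by auto
    obtain a where a: "a < n" "ws ! a = vs ! i" using ex1 ij by blast
    show "(P * Q) $$ (i, j) = 1\<^sub>m n $$ (i, j)"
      using ij a dv lv by (simp add: P_def Q_def scalar_prod_def sum1[OF ij(1) a] nth_eq_iff_index_eq)
  qed (auto simp: P_def Q_def)
  have QP: "Q * P = 1\<^sub>m n"
  proof (rule eq_matI)
    fix i j assume "i < dim_row (1\<^sub>m n :: complex mat)" "j < dim_col (1\<^sub>m n :: complex mat)"
    then have ij: "i < n" "j < n" by auto
    obtain a where a: "a < n" "vs ! a = ws ! i" using ex2 ij by blast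
    show "(Q * P) $$ (i, j) = 1\<^sub>m n $$ (i, j)"
      using ij a dw lw by (simp add: P_def Q_def scalar_prod_def sum3[OF ij(1) a] nth_eq_iff_index_eq)
  qed (auto simp: P_def Q_def)
  have "adjacency_mat G vs = P * adjacency_mat G ws * Q"
  proof (rule eq_matI)
    fix i j assume "i < dim_row (P * adjacency_mat G ws * Q)" "j < dim_col (P * adjacency_mat G ws * Q)"
    then have ij: "i < n" "j < n" by (auto simp: P_def Q_def)
    obtain a where a: "a < n" "ws ! a = vs ! i" using ex1 ij by blast
    obtain b where b: "b < n" "ws ! b = vs ! j" using ex1 ij by blast
    have *: "(P * adjacency_mat G ws) $$ (i, l) = adjacency_mat G ws $$ (a, l)" if "l < n" for l
      using ij a that lw by (simp add: P_def adjacency_mat_def scalar_prod_def sum1[OF ij(1) a])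
    have "(P * adjacency_mat G ws * Q) $$ (i, j)
        = (\<Sum>l = 0..<n. (P * adjacency_mat G ws) $$ (i, l) * (if ws ! l = vs ! j then 1 else 0))"
      using ij lw by (simp add: P_def Q_def adjacency_mat_def scalar_prod_def)
    also have "\<dots> = adjacency_mat G ws $$ (a, b)"
      using * b by (simp add: sum2[OF ij(2) b])
    also have "\<dots> = adjacency_mat G vs $$ (i, j)"
      using ij a b lw lv by (simp add: adjacency_mat_def)
    finally show "adjacency_mat G vs $$ (i, j) = (P * adjacency_mat G ws * Q) $$ (i, j)" by simp
  qed (auto simp: P_def Q_def adjacency_mat_def lv)
  then show ?thesis
    using PQ QP lv lw by (intro similar_matI[of _ _ P Q n]) (auto simp: P_def Q_def adjacency_mat_def)
qed

lemma graph_energy_eq: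
  assumes "vertex_enum G vs"
  shows "graph_energy G = mat_energy (adjacency_mat G vs)"
proof -
  let ?ws = "SOME vs. vertex_enum G vs"
  have ws: "vertex_enum G ?ws" using assms by (rule someI)
  have cp: "char_poly (adjacency_mat G ?ws) = char_poly (adjacency_mat G vs)"
    by (rule char_poly_similar[OF similar_adjacency_mat[OF ws assms]])
  have carr: "adjacency_mat G us \<in> carrier_mat (length us) (length us)" for us
    by (simp add: adjacency_mat_def)
  have "spectrum (adjacency_mat G ?ws) = spectrum (adjacency_mat G vs)"
    by (auto simp: spectrum_def eigenvalue_root_char_poly[OF carr] cp)
  then show ?thesis by (simp add: graph_energy_def mat_energy_def cp)
qed

datatype wgp_vertex = Vp nat | Vq nat | Vr nat | Vs nat | Vt nat

definition wgp_edges :: "nat \<Rightarrow> (wgp_vertex \<times> wgp_vertex) set" where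
  "wgp_edges k =
     (\<Union>j<k. {(Vp j, Vq j), (Vq j, Vp (j + 1)), (Vq j, Vr j), (Vr j, Vs j), (Vr j, Vt j), (Vs j, Vt j)})"

definition wine_glass_path :: "nat \<Rightarrow> wgp_vertex pair_pre_digraph" where
  "wine_glass_path k =
     \<lparr> pverts = Vp ` {..k} \<union> Vq ` {..<k} \<union> Vr ` {..<k} \<union> Vs ` {..<k} \<union> Vt ` {..<k},
       parcs = wgp_edges k \<union> (wgp_edges k)\<inverse> \<rparr>"

lemma pair_graph_wine_glass_path: "pair_graph (wine_glass_path k)"
  by unfold_locales
     (auto simp: wine_glass_path_def wgp_edges_def symmetric_def sym_def arcs_ends_def arc_to_ends_def)

lemma card_wine_glass_path: "card (pverts (wine_glass_path k)) = 5 * k + 1"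
  unfolding wine_glass_path_def pair_pre_digraph.simps
  by (subst card_Un_disjoint; (auto simp: card_image inj_on_def)?)+

definition wgp_fun :: "real \<Rightarrow> real" where
  "wgp_fun x = x\<^sup>2 - 3 - 2 / ((x + 1) * (x - 2))"

definition wgp_alpha :: "real \<Rightarrow> real" where
  "wgp_alpha y = (THE x. x < -1 \<and> wgp_fun x = y)"

definition wgp_beta :: "real \<Rightarrow> real" where
  "wgp_beta y = (THE x. -1 < x \<and> x \<le> 0 \<and> wgp_fun x = y)"

lemma wgp_fun_diff:
  assumes "x \<noteq> -1" "x \<noteq> 2" "z \<noteq> -1" "z \<noteq> 2"
  shows "wgp_fun x - wgp_fun z
    = (x - z) * ((x + z) + 2 * (x + z - 1) / ((x + 1) * (x - 2) * ((z + 1) * (z - 2))))"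
proof -
  define X Z where "X = (x + 1) * (x - 2)" and "Z = (z + 1) * (z - 2)"
  have ne: "X \<noteq> 0" "Z \<noteq> 0" using assms by (auto simp: X_def Z_def)
  have "wgp_fun x - wgp_fun z = (x\<^sup>2 - z\<^sup>2) + (2 / Z - 2 / X)"
    by (simp add: wgp_fun_def X_def Z_def)
  also have "2 / Z - 2 / X = 2 * (X - Z) / (X * Z)"
    using ne by (simp add: field_simps)
  also have "X - Z = (x - z) * (x + z - 1)"
    by (simp add: X_def Z_def algebra_simps)
  also have "x\<^sup>2 - z\<^sup>2 + 2 * ((x - z) * (x + z - 1)) / (X * Z)
      = (x - z) * ((x + z) + 2 * (x + z - 1) / (X * Z))"
    by (simp add: distrib_left power2_eq_square square_diff_square_factored mult.left_commute mult.commute)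
  finally show ?thesis by (simp add: X_def Z_def)
qed

lemma wgp_fun_inj:
  assumes "x \<le> 0" "z \<le> 0" "x < -1 \<and> z < -1 \<or> -1 < x \<and> -1 < z" "wgp_fun x = wgp_fun z"
  shows "x = z"
proof (rule ccontr)
  assume ne: "x \<noteq> z"
  define D where "D = (x + 1) * (x - 2) * ((z + 1) * (z - 2))"
  have "D > 0"
    using assms(1-3) unfolding D_def
    by (auto intro!: mult_pos_pos mult_neg_neg mult_pos_neg simp: zero_less_mult_iff mult_less_0_iff)
  then have "2 * (x + z - 1) / D < 0" using assms(1,2) by (simp add: divide_less_0_iff)
  then have "(x + z) + 2 * (x + z - 1) / D < 0" using assms(1,2) by linarith
  moreover have "wgp_fun x - wgp_fun z = (x - z) * ((x + z) + 2 * (x + z - 1) / D)"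
    unfolding D_def using assms by (intro wgp_fun_diff) auto
  ultimately show False using ne assms(4) by auto
qed

lemma wgp_alpha_ex1:
  assumes "y \<in> {-2..2}"
  shows "\<exists>!x. x < -1 \<and> wgp_fun x = y"
proof -
  have "\<exists>x\<ge>-3. x \<le> -11/10 \<and> wgp_fun x = y"
    using assms by (intro IVT2') (auto simp: wgp_fun_def power2_eq_square intro!: continuous_intros)
  then obtain x where "x < -1" "wgp_fun x = y" by force
  then show ?thesis using wgp_fun_inj by (intro ex1I[of _ x]) auto
qed

lemma wgp_beta_ex1:
  assumes "y \<in> {-2..2}"
  shows "\<exists>!x. -1 < x \<and> x \<le> 0 \<and> wgp_fun x = y"
proof -
  have "\<exists>x\<ge>-9/10. x \<le> 0 \<and> wgp_fun x = y"
    using assms by (intro IVT2') (auto simp: wgp_fun_def power2_eq_square intro!: continuous_intros)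
  then obtain x where "-1 < x" "x \<le> 0" "wgp_fun x = y" by force
  then show ?thesis using wgp_fun_inj by (intro ex1I[of _ x]) auto
qed

end

theory Submission
  imports Defs
begin

text \<open>
  The proof exhibits an orthogonal eigenbasis. The vectors \<open>s\<^sub>j - t\<^sub>j\<close> give the eigenvalue \<open>-1\<close>
  \<open>k\<close> times, and alternating signs on the \<open>p\<close>-vertices give the eigenvalue \<open>0\<close> once. For every
  other eigenvalue \<open>x\<close>, elimination of all vertices but the \<open>q\<^sub>i\<close> leaves the path recurrence
  \<open>q\<^sub>i\<^sub>-\<^sub>1 + q\<^sub>i\<^sub>+\<^sub>1 = wgp_fun x * q\<^sub>i\<close> with zero boundary values, so \<open>wgp_fun x = y\<close> for one of the
  \<open>k\<close> numbers \<open>y = 2 cos (j\<pi> / (k + 1))\<close>. Clearing denominators gives a quartic with cubic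
  coefficient \<open>-1\<close>, two negative roots \<open>\<alpha> y\<close>, \<open>\<beta> y\<close> and two positive ones, so the absolute
  values of its roots add up to \<open>1 - 2 \<alpha> y - 2 \<beta> y\<close>.
\<close>

section \<open>Energy from an orthogonal eigenbasis\<close>

text \<open>The matrix \<open>P\<close> with columns \<open>w i\<close> is inverted by the matrix
  \<open>Q\<close> with rows \<open>w i\<close> divided by \<open>w i \<bullet> w i\<close>, so
  \<open>A\<close> is similar to a diagonal matrix. The product \<open>\<bullet>\<close> involves no
  conjugation and may vanish on a nonzero vector, hence the last hypothesis.\<close>

lemma char_poly_orthogonal_eigenbasis:
  fixes A :: "'a :: field mat"
  assumes A: "A \<in> carrier_mat n n"
    and w: "\<And>i. i < n \<Longrightarrow> w i \<in> carrier_vec n"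
    and ev: "\<And>i. i < n \<Longrightarrow> A *\<^sub>v w i = d i \<cdot>\<^sub>v w i"
    and orth: "\<And>i j. \<lbrakk>i < n; j < n; i \<noteq> j\<rbrakk> \<Longrightarrow> w i \<bullet> w j = 0"
    and nz: "\<And>i. i < n \<Longrightarrow> w i \<bullet> w i \<noteq> 0"
  shows "char_poly A = (\<Prod>i<n. [:- d i, 1:])"
proof -
  define P where "P = mat n n (\<lambda>(a, b). w b $ a)"
  define Q where "Q = mat n n (\<lambda>(a, b). w a $ b / (w a \<bullet> w a))"
  define D where "D = mat n n (\<lambda>(a, b). if a = b then d a else 0)"
  have P: "P \<in> carrier_mat n n" and Q: "Q \<in> carrier_mat n n" and D: "D \<in> carrier_mat n n"
    by (auto simp: P_def Q_def D_def)
  have colP: "col P j = w j" if "j < n" for j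
    using that w[OF that] by (intro eq_vecI) (auto simp: P_def)
  have rowQ: "row Q i = (1 / (w i \<bullet> w i)) \<cdot>\<^sub>v w i" if "i < n" for i
    using that w[OF that] by (intro eq_vecI) (auto simp: Q_def)
  have QP: "Q * P = 1\<^sub>m n"
  proof (rule eq_matI)
    fix i j assume "i < dim_row (1\<^sub>m n :: 'a mat)" "j < dim_col (1\<^sub>m n :: 'a mat)"
    then have ij: "i < n" "j < n" by auto
    have "(Q * P) $$ (i, j) = (1 / (w i \<bullet> w i)) * (w i \<bullet> w j)"
      using ij P Q smult_scalar_prod_distrib[OF w w, of i j] by (simp add: colP rowQ)
    then show "(Q * P) $$ (i, j) = 1\<^sub>m n $$ (i, j)"
      using ij orth nz by (cases "i = j") auto
  qed (use P Q in auto)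
  then have PQ: "P * Q = 1\<^sub>m n"
    by (rule mat_mult_left_right_inverse[OF Q P])
  have AP: "A * P = P * D"
  proof (rule eq_matI)
    fix i j assume "i < dim_row (P * D)" "j < dim_col (P * D)"
    then have ij: "i < n" "j < n" using P D by auto
    have "(A * P) $$ (i, j) = (A *\<^sub>v w j) $ i"
      using ij A P by (simp add: colP)
    also have "\<dots> = d j * w j $ i"
      using ij w[of j] by (simp add: ev)
    also have "\<dots> = (\<Sum>l = 0..<n. if l = j then P $$ (i, l) * d l else 0)"
      using ij by (simp add: P_def)
    also have "\<dots> = (P * D) $$ (i, j)"
      using ij P by (simp add: D_def scalar_prod_def if_distrib[of "(*) _"] cong: if_cong)
    finally show "(A * P) $$ (i, j) = (P * D) $$ (i, j)" .
  qed (use A P D in auto)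
  have "A = A * (P * Q)" using A by (simp add: PQ)
  also have "\<dots> = P * D * Q" using A P Q by (simp add: AP flip: assoc_mult_mat)
  finally have "A = P * D * Q" .
  then have "similar_mat A D"
    using A P Q D PQ QP by (intro similar_matI[of _ _ P Q n]) auto
  then have "char_poly A = char_poly D" by (rule char_poly_similar)
  also have "\<dots> = (\<Prod>a\<leftarrow>diag_mat D. [:- a, 1:])"
    using D by (intro char_poly_upper_triangular) (auto simp: D_def)
  also have "\<dots> = (\<Prod>i\<leftarrow>[0..<n]. [:- d i, 1:])"
    by (auto simp: diag_mat_def D_def o_def intro!: arg_cong[of _ _ prod_list])
  also have "\<dots> = (\<Prod>i<n. [:- d i, 1:])"
    by (subst prod.distinct_set_conv_list[symmetric]) (auto simp: lessThan_atLeast0)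
  finally show ?thesis .
qed

text \<open>Orders add up over products, and a linear factor contributes 1 at its root and 0
  elsewhere. This turns multiplicities into numbers of indices.\<close>

lemma order_prod_linear_factors:
  fixes d :: "'i \<Rightarrow> 'a :: idom"
  assumes "finite I"
  shows "order x (\<Prod>i\<in>I. [:- d i, 1:]) = card {i \<in> I. d i = x}"
  using assms
proof (induction I rule: finite_induct)
  case empty
  then show ?case by (simp add: order_0I)
next
  case (insert i I)
  have "[:- d i, 1:] * (\<Prod>i\<in>I. [:- d i, 1:]) \<noteq> 0"
    using insert.hyps by (subst mult_eq_0_iff, subst prod_zero_iff) auto
  then have "order x (\<Prod>i\<in>insert i I. [:- d i, 1:]) = order x [:- d i, 1:] + card {i \<in> I. d i = x}"
    unfolding insert.IH[symmetric] prod.insert[OF insert.hyps] by (rule order_mult)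
  moreover have "order x [:- d i, 1:] = (if d i = x then 1 else 0)"
    using order_power_n_n[of x 1] by (auto intro: order_0I)
  moreover have "{j \<in> insert i I. d j = x} = (if d i = x then {i} else {}) \<union> {j \<in> I. d j = x}"
    by auto
  ultimately show ?case using insert.hyps by auto
qed

text \<open>Since \<open>order x\<close> is the size of the fibre of \<open>d\<close> over
  \<open>x\<close>, weighting each eigenvalue by its multiplicity amounts to summing over all
  indices.\<close>

lemma mat_energy_char_poly:
  assumes A: "A \<in> carrier_mat n n" and "finite I"
    and cp: "char_poly A = (\<Prod>i\<in>I. [:- d i, 1:])"
  shows "mat_energy A = (\<Sum>i\<in>I. cmod (d i))"
proof -
  have "spectrum A = d ` I"
    using \<open>finite I\<close>
    by (auto simp: spectrum_def eigenvalue_root_char_poly[OF A] cp poly_prod)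
  then have "mat_energy A = (\<Sum>x\<in>d ` I. \<Sum>i | i \<in> I \<and> d i = x. cmod (d i))"
    by (simp add: mat_energy_def cp order_prod_linear_factors[OF \<open>finite I\<close>])
  also have "\<dots> = (\<Sum>i\<in>I. cmod (d i))"
    using sum.image_gen[OF \<open>finite I\<close>, of "\<lambda>i. cmod (d i)" d] by simp
  finally show ?thesis .
qed

text \<open>
  Symmetry of the adjacency matrix makes eigenvectors of distinct eigenvalues orthogonal, so
  orthogonality has to be checked within eigenspaces only.
\<close>

lemma graph_energy_eigenbasis:
  fixes f :: "'i \<Rightarrow> 'v \<Rightarrow> real" and d :: "'i \<Rightarrow> real"
  assumes G: "pair_graph G"
    and I: "finite I" "card I = card (pverts G)"
    and ev: "\<And>i u. \<lbrakk>i \<in> I; u \<in> pverts G\<rbrakk> \<Longrightarrow> (\<Sum>v | (u, v) \<in> parcs G. f i v) = d i * f i u"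
    and orth: "\<And>i j. \<lbrakk>i \<in> I; j \<in> I; i \<noteq> j; d i = d j\<rbrakk> \<Longrightarrow> (\<Sum>v\<in>pverts G. f i v * f j v) = 0"
    and nz: "\<And>i. i \<in> I \<Longrightarrow> \<exists>v\<in>pverts G. f i v \<noteq> 0"
  shows "graph_energy G = (\<Sum>i\<in>I. \<bar>d i\<bar>)"
proof -
  interpret pair_graph G by (rule G)
  define V where "V = pverts G"
  define a where "a u v = (if (u, v) \<in> parcs G then 1 else 0 :: real)" for u v
  have finV: "finite V" by (simp add: V_def)
  obtain vs where vs: "set vs = V" "distinct vs" using finite_distinct_list[OF finV] by auto
  define n where "n = length vs"
  have n: "card I = n" using vs I by (simp add: n_def V_def flip: distinct_card)
  \<comment> \<open>Having as many eigenvectors as vertices allows \<open>I\<close> to be numbered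
    by the columns of an \<open>n\<close> by \<open>n\<close> matrix.\<close>
  obtain e where e: "bij_betw e {..<n} I"
    using ex_bij_betw_nat_finite[OF I(1)] n by (auto simp: lessThan_atLeast0)
  have eI: "e i \<in> I" if "i < n" for i using e that by (auto simp: bij_betw_def)
  have sym: "a u v = a v u" for u v
    using arcs_symmetric by (auto simp: a_def)
  have ev': "(\<Sum>v\<in>V. a u v * f i v) = d i * f i u" if "i \<in> I" "u \<in> V" for i u
  proof -
    have "(\<Sum>v\<in>V. a u v * f i v) = (\<Sum>v | (u, v) \<in> parcs G. f i v)"
      using finV by (intro sum.mono_neutral_cong_right) (auto simp: a_def V_def dest: in_arcsD2)
    then show ?thesis using ev that by (simp add: V_def)
  qed
  have orth': "(\<Sum>v\<in>V. f i v * f j v) = 0" if ij: "i \<in> I" "j \<in> I" "i \<noteq> j" for i j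
  proof (cases "d i = d j")
    case False
    have "d i * (\<Sum>v\<in>V. f i v * f j v) = (\<Sum>u\<in>V. (\<Sum>v\<in>V. a u v * f i v) * f j u)"
      using ij by (simp add: ev' sum_distrib_left mult.assoc)
    also have "\<dots> = (\<Sum>u\<in>V. \<Sum>v\<in>V. a u v * f i v * f j u)" by (simp add: sum_distrib_right)
    also have "\<dots> = (\<Sum>v\<in>V. \<Sum>u\<in>V. a u v * f i v * f j u)" by (rule sum.swap)
    also have "\<dots> = (\<Sum>v\<in>V. f i v * (\<Sum>u\<in>V. a v u * f j u))"
      by (simp add: sum_distrib_left mult_ac sym)
    also have "\<dots> = d j * (\<Sum>v\<in>V. f i v * f j v)"
      using ij by (simp add: ev' sum_distrib_left mult_ac)
    finally show ?thesis using False by simp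
  qed (use orth ij in \<open>simp add: V_def\<close>)
  define A where "A = adjacency_mat G vs"
  define w where "w i = vec n (\<lambda>l. complex_of_real (f (e i) (vs ! l)))" for i
  have A: "A \<in> carrier_mat n n" by (simp add: A_def adjacency_mat_def n_def)
  have sum_vs: "(\<Sum>l = 0..<n. g (vs ! l)) = (\<Sum>v\<in>V. g v)" for g :: "'v \<Rightarrow> real"
    using vs by (simp add: n_def sum.distinct_set_conv_list sum_list_sum_nth flip: vs(1))
  have scal: "w i \<bullet> w j = complex_of_real (\<Sum>v\<in>V. f (e i) v * f (e j) v)" for i j
    by (simp add: w_def scalar_prod_def flip: sum_vs)
  have "char_poly A = (\<Prod>i<n. [:- complex_of_real (d (e i)), 1:])"
  proof (rule char_poly_orthogonal_eigenbasis[OF A, of w])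
    show "A *\<^sub>v w i = complex_of_real (d (e i)) \<cdot>\<^sub>v w i" if "i < n" for i
    proof (rule eq_vecI)
      fix l assume "l < dim_vec (complex_of_real (d (e i)) \<cdot>\<^sub>v w i)"
      then have l: "l < n" by (simp add: w_def)
      then have "vs ! l \<in> V" using vs by (auto simp: n_def)
      have "(A *\<^sub>v w i) $ l = complex_of_real (\<Sum>m = 0..<n. a (vs ! l) (vs ! m) * f (e i) (vs ! m))"
        using l unfolding of_real_sum
        by (auto simp: A_def adjacency_mat_def w_def scalar_prod_def a_def n_def intro!: sum.cong)
      also have "\<dots> = complex_of_real (d (e i) * f (e i) (vs ! l))"
        using ev'[OF eI[OF that] \<open>vs ! l \<in> V\<close>]
        by (subst sum_vs[of "\<lambda>v. a (vs ! l) v * f (e i) v"]) simp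
      finally show "(A *\<^sub>v w i) $ l = (complex_of_real (d (e i)) \<cdot>\<^sub>v w i) $ l"
        using l by (simp add: w_def)
    qed (use A in \<open>auto simp: w_def\<close>)
    show "w i \<bullet> w j = 0" if "i < n" "j < n" "i \<noteq> j" for i j
    proof -
      have "e i \<noteq> e j" using e that by (auto simp: bij_betw_def inj_on_def)
      then show ?thesis using that by (subst scal, subst orth') (auto intro: eI)
    qed
    show "w i \<bullet> w i \<noteq> 0" if "i < n" for i
    proof -
      \<comment> \<open>The vectors are real, so the product without conjugation is a sum of
        squares.\<close>
      obtain v where "v \<in> V" "f (e i) v \<noteq> 0" using nz[OF eI[OF \<open>i < n\<close>]] by (auto simp: V_def)
      then have "(\<Sum>v\<in>V. f (e i) v * f (e i) v) > 0"
        using finV by (intro sum_pos2[of _ v]) (auto simp: zero_less_mult_iff)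
      then show ?thesis by (simp only: scal of_real_eq_0_iff)
    qed
  qed (simp add: w_def)
  then have "mat_energy A = (\<Sum>i<n. cmod (complex_of_real (d (e i))))"
    by (intro mat_energy_char_poly[OF A]) auto
  also have "\<dots> = (\<Sum>i\<in>I. \<bar>d i\<bar>)"
    using sum.reindex_bij_betw[OF e, of "\<lambda>i. \<bar>d i\<bar>"] by simp
  finally show ?thesis
    using graph_energy_eq[of G vs] vs by (simp add: vertex_enum_def A_def V_def)
qed

section \<open>The quartic behind \<open>wgp_fun\<close> and its roots\<close>

text \<open>Vieta by divided differences: those of first order (\<open>d1\<close>) and second order
  (\<open>d2\<close>) vanish at distinct roots, and the one of third order is
  \<open>a + b + c + d + e3\<close>.\<close>

lemma sum_roots_quartic:
  fixes a b c d :: "'a :: idom"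
  assumes root: "\<And>x. x \<in> {a, b, c, d} \<Longrightarrow> x ^ 4 + e3 * x ^ 3 + e2 * x ^ 2 + e1 * x + e0 = 0"
    and dist: "distinct [a, b, c, d]"
  shows "a + b + c + d = - e3"
proof -
  have d1: "x^3 + x^2*y + x*y^2 + y^3 + e3 * (x^2 + x*y + y^2) + e2 * (x + y) + e1 = 0"
    if "x \<in> {a, b, c, d}" "y \<in> {a, b, c, d}" "x \<noteq> y" for x y
  proof -
    have "(x - y) * (x^3 + x^2*y + x*y^2 + y^3 + e3 * (x^2 + x*y + y^2) + e2 * (x + y) + e1)
        = (x ^ 4 + e3 * x ^ 3 + e2 * x ^ 2 + e1 * x + e0) - (y ^ 4 + e3 * y ^ 3 + e2 * y ^ 2 + e1 * y + e0)"
      by (simp add: algebra_simps power4_eq_xxxx power3_eq_cube power2_eq_square)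
    also have "\<dots> = 0" by (simp only: root that diff_self)
    finally have "(x - y) * (x^3 + x^2*y + x*y^2 + y^3 + e3 * (x^2 + x*y + y^2) + e2 * (x + y) + e1) = 0" .
    then show ?thesis using that(3) by simp
  qed
  have d2: "a^2 + a*x + a*b + b^2 + b*x + x^2 + e3 * (a + b + x) + e2 = 0"
    if "x \<in> {c, d}" for x
  proof -
    have "(b - x) * (a^2 + a*x + a*b + b^2 + b*x + x^2 + e3 * (a + b + x) + e2)
        = (a^3 + a^2*b + a*b^2 + b^3 + e3 * (a^2 + a*b + b^2) + e2 * (a + b) + e1)
        - (a^3 + a^2*x + a*x^2 + x^3 + e3 * (a^2 + a*x + x^2) + e2 * (a + x) + e1)"
      by (simp add: algebra_simps power3_eq_cube power2_eq_square)
    also have "\<dots> = 0"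
    proof -
      have "a \<noteq> b" "a \<noteq> x" "x \<in> {a, b, c, d}" using that dist by auto
      then show ?thesis by (simp only: d1 insert_iff simp_thms diff_self)
    qed
    finally show ?thesis using that dist by auto
  qed
  have "(c - d) * (a + b + c + d + e3)
      = (a^2 + a*c + a*b + b^2 + b*c + c^2 + e3 * (a + b + c) + e2)
      - (a^2 + a*d + a*b + b^2 + b*d + d^2 + e3 * (a + b + d) + e2)"
    by (simp add: algebra_simps power2_eq_square)
  also have "\<dots> = 0" by (simp add: d2)
  finally show ?thesis using dist by (simp add: eq_neg_iff_add_eq_0)
qed

text \<open>Multiplication by \<open>(x + 1) * (x - 2)\<close> clears the denominator. The factor
  \<open>(-1)\<close> keeps the shape used in \<open>sum_roots_quartic\<close>.\<close>

lemma wgp_fun_eq_iff: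
  assumes "x \<noteq> -1" "x \<noteq> 2"
  shows "wgp_fun x = y \<longleftrightarrow> x ^ 4 + (-1) * x ^ 3 + (- 5 - y) * x ^ 2 + (3 + y) * x + (4 + 2 * y) = 0"
proof -
  define D where "D = (x + 1) * (x - 2)"
  have "D \<noteq> 0" using assms by (auto simp: D_def)
  have "wgp_fun x = x\<^sup>2 - 3 - 2 / D" by (simp only: wgp_fun_def D_def)
  with \<open>D \<noteq> 0\<close> have "wgp_fun x = y \<longleftrightarrow> (x\<^sup>2 - 3) * D - 2 = y * D"
    by (auto simp: field_simps)
  also have "\<dots> \<longleftrightarrow> x ^ 4 + (-1) * x ^ 3 + (- 5 - y) * x ^ 2 + (3 + y) * x + (4 + 2 * y) = 0"
    unfolding D_def eq_iff_diff_eq_0[of "_ - 2"]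
    by (simp add: algebra_simps power4_eq_xxxx power3_eq_cube power2_eq_square)
  finally show ?thesis .
qed

text \<open>The strict bound \<open>-2 < y\<close> keeps 0 from being a root; the wave eigenvectors
  below divide by \<open>x\<close>.\<close>

lemma wgp_fun_roots:
  assumes y: "-2 < y" "y \<le> 2"
  shows "\<exists>R. card R = 4 \<and> (\<forall>x\<in>R. x \<noteq> -1 \<and> x \<noteq> 0 \<and> x \<noteq> 2 \<and> wgp_fun x = y)
    \<and> (\<Sum>x\<in>R. \<bar>x\<bar>) = 1 - 2 * wgp_alpha y - 2 * wgp_beta y"
proof -
  define Q where "Q x = x ^ 4 + (-1) * x ^ 3 + (- 5 - y) * x ^ 2 + (3 + y) * x + (4 + 2 * y)" for x
  define a b where "a = wgp_alpha y" and "b = wgp_beta y"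
  have a: "a < -1" "wgp_fun a = y"
    using theI'[OF wgp_alpha_ex1[of y]] y by (auto simp: a_def wgp_alpha_def)
  have b: "-1 < b" "b \<le> 0" "wgp_fun b = y"
    using theI'[OF wgp_beta_ex1[of y]] y by (auto simp: b_def wgp_beta_def)
  \<comment> \<open>The values are \<open>4 + 2 * y\<close>, \<open>-2\<close> and
    \<open>22 - 4 * y\<close>; the sign changes locate the two positive roots.\<close>
  have Q0: "Q 0 > 0" and Q2: "Q 2 < 0" and Q3: "Q 3 > 0" using y by (auto simp: Q_def)
  have cont: "continuous_on S Q" for S unfolding Q_def by (intro continuous_intros)
  obtain c where c: "0 \<le> c" "c \<le> 2" "Q c = 0"
    using IVT2'[of Q 2 0 0] Q0 Q2 cont by auto
  obtain d where d: "2 \<le> d" "d \<le> 3" "Q d = 0"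
    using IVT'[of Q 2 0 3] Q2 Q3 cont by auto
  have c': "0 < c" "c < 2" and d': "2 < d"
    using c d Q0 Q2 by (auto simp: less_le)
  have Q_root: "Q x = 0 \<longleftrightarrow> wgp_fun x = y" if "x \<noteq> -1" "x \<noteq> 2" for x
    unfolding Q_def by (rule wgp_fun_eq_iff[OF that, symmetric])
  have Qa: "Q a = 0" and Qb: "Q b = 0" using a b by (auto simp: Q_root)
  then have b': "b < 0" using b(2) Q0 by (auto simp: less_le)
  have dist: "distinct [a, b, c, d]" using a b b' c' d' by auto
  have "a + b + c + d = - (-1)"
    by (rule sum_roots_quartic[OF _ dist]) (use Qa Qb c d in \<open>auto simp: Q_def\<close>)
  \<comment> \<open>As \<open>a\<close>, \<open>b\<close> are negative and \<open>c\<close>,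
    \<open>d\<close> positive, the left side is
    \<open>(a + b + c + d) - 2 * a - 2 * b\<close>.\<close>
  then have "(\<Sum>x\<in>{a, b, c, d}. \<bar>x\<bar>) = 1 - 2 * a - 2 * b"
    using dist a b' c' d' by simp
  moreover have "card {a, b, c, d} = 4" using dist by simp
  moreover have "wgp_fun c = y" "wgp_fun d = y"
    using c d c' d' by (auto simp flip: Q_root)
  ultimately show ?thesis
    using a b b' c' d' by (intro exI[of _ "{a, b, c, d}"]) (auto simp: a_def b_def)
qed

section \<open>Eigenvectors of the wine glass path\<close>

text \<open>Reduces the eigenvector equation to one equation per kind of vertex. The conditionals in
  \<open>p\<close> account for the missing neighbours at the ends \<open>Vp 0\<close> and
  \<open>Vp k\<close>.\<close>

lemma wgp_eigenvectorI:
  fixes g :: "wgp_vertex \<Rightarrow> real"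
  assumes p: "\<And>i. i \<le> k \<Longrightarrow>
      (if 0 < i then g (Vq (i - 1)) else 0) + (if i < k then g (Vq i) else 0) = x * g (Vp i)"
    and q: "\<And>i. i < k \<Longrightarrow> g (Vp i) + g (Vp (i + 1)) + g (Vr i) = x * g (Vq i)"
    and r: "\<And>i. i < k \<Longrightarrow> g (Vq i) + g (Vs i) + g (Vt i) = x * g (Vr i)"
    and s: "\<And>i. i < k \<Longrightarrow> g (Vr i) + g (Vt i) = x * g (Vs i)"
    and t: "\<And>i. i < k \<Longrightarrow> g (Vr i) + g (Vs i) = x * g (Vt i)"
    and u: "u \<in> pverts (wine_glass_path k)"
  shows "(\<Sum>v | (u, v) \<in> parcs (wine_glass_path k). g v) = x * g u"
proof -
  let ?N = "\<lambda>u. {v. (u, v) \<in> parcs (wine_glass_path k)}"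
  have Np: "?N (Vp i) = (if 0 < i then {Vq (i - 1)} else {}) \<union> (if i < k then {Vq i} else {})"
    if "i \<le> k" for i
    using that by (auto simp: wine_glass_path_def wgp_edges_def)
  have Nq: "?N (Vq i) = {Vp i, Vp (i + 1), Vr i}" if "i < k" for i
    using that by (auto simp: wine_glass_path_def wgp_edges_def)
  have Nr: "?N (Vr i) = {Vq i, Vs i, Vt i}" if "i < k" for i
    using that by (auto simp: wine_glass_path_def wgp_edges_def)
  have Ns: "?N (Vs i) = {Vr i, Vt i}" if "i < k" for i
    using that by (auto simp: wine_glass_path_def wgp_edges_def)
  have Nt: "?N (Vt i) = {Vr i, Vs i}" if "i < k" for i
    using that by (auto simp: wine_glass_path_def wgp_edges_def)
  show ?thesis
  proof (cases u)
    case (Vp i)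
    then have i: "i \<le> k" using u by (auto simp: wine_glass_path_def)
    show ?thesis unfolding Vp Np[OF i] p[OF i, symmetric] by auto
  next
    case (Vq i)
    then have i: "i < k" using u by (auto simp: wine_glass_path_def)
    show ?thesis unfolding Vq Nq[OF i] q[OF i, symmetric] by simp
  next
    case (Vr i)
    then have i: "i < k" using u by (auto simp: wine_glass_path_def)
    show ?thesis unfolding Vr Nr[OF i] r[OF i, symmetric] by simp
  next
    case (Vs i)
    then have i: "i < k" using u by (auto simp: wine_glass_path_def)
    show ?thesis unfolding Vs Ns[OF i] s[OF i, symmetric] by simp
  next
    case (Vt i)
    then have i: "i < k" using u by (auto simp: wine_glass_path_def)
    show ?thesis unfolding Vt Nt[OF i] t[OF i, symmetric] by simp
  qed
qed

fun wgp_null_vec :: "wgp_vertex \<Rightarrow> real" where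
  "wgp_null_vec (Vp i) = (-1) ^ i"
| "wgp_null_vec _ = 0"

fun wgp_bowl_vec :: "nat \<Rightarrow> wgp_vertex \<Rightarrow> real" where
  "wgp_bowl_vec j (Vs i) = (if i = j then 1 else 0)"
| "wgp_bowl_vec j (Vt i) = (if i = j then -1 else 0)"
| "wgp_bowl_vec j _ = 0"

text \<open>The sine values on the \<open>Vq i\<close> are prescribed and the others solved for:
  \<open>x * p = q + q'\<close> at a \<open>Vp\<close> with neighbours \<open>q\<close>,
  \<open>q'\<close>; in a bowl \<open>s = t\<close> and \<open>r = (x - 1) * s\<close>, so that
  \<open>q + 2 * s = x * r\<close> gives \<open>q = (x + 1) * (x - 2) * s\<close>.\<close>

fun wgp_wave_vec :: "real \<Rightarrow> real \<Rightarrow> wgp_vertex \<Rightarrow> real" where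
  "wgp_wave_vec \<theta> x (Vp i) = (sin (real i * \<theta>) + sin (real (i + 1) * \<theta>)) / x"
| "wgp_wave_vec \<theta> x (Vq i) = sin (real (i + 1) * \<theta>)"
| "wgp_wave_vec \<theta> x (Vr i) = (x - 1) * sin (real (i + 1) * \<theta>) / ((x + 1) * (x - 2))"
| "wgp_wave_vec \<theta> x (Vs i) = sin (real (i + 1) * \<theta>) / ((x + 1) * (x - 2))"
| "wgp_wave_vec \<theta> x (Vt i) = sin (real (i + 1) * \<theta>) / ((x + 1) * (x - 2))"

text \<open>Each \<open>Vq i\<close> sees opposite values at \<open>Vp i\<close> and
  \<open>Vp (i + 1)\<close>; all other vertices see zeros only.\<close>

lemma wgp_null_vec_eigen:
  "u \<in> pverts (wine_glass_path k) \<Longrightarrow>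
    (\<Sum>v | (u, v) \<in> parcs (wine_glass_path k). wgp_null_vec v) = 0 * wgp_null_vec u"
  by (rule wgp_eigenvectorI[where k = k]) auto

text \<open>The two entries cancel at \<open>Vr j\<close>, while \<open>Vs j\<close> and
  \<open>Vt j\<close> each see the negative of their own value.\<close>

lemma wgp_bowl_vec_eigen:
  "u \<in> pverts (wine_glass_path k) \<Longrightarrow>
    (\<Sum>v | (u, v) \<in> parcs (wine_glass_path k). wgp_bowl_vec j v) = -1 * wgp_bowl_vec j u"
  by (rule wgp_eigenvectorI[where k = k]) auto

lemma wgp_wave_vec_eigen:
  assumes x: "x \<noteq> -1" "x \<noteq> 0" "x \<noteq> 2" and F: "wgp_fun x = 2 * cos \<theta>"
    and \<theta>: "sin (real (k + 1) * \<theta>) = 0"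
    and u: "u \<in> pverts (wine_glass_path k)"
  shows "(\<Sum>v | (u, v) \<in> parcs (wine_glass_path k). wgp_wave_vec \<theta> x v) = x * wgp_wave_vec \<theta> x u"
proof -
  define D where "D = (x + 1) * (x - 2)"
  have D: "D \<noteq> 0" using x by (auto simp: D_def)
  \<comment> \<open>Serves to replace \<open>x * (x - 1)\<close> by \<open>D + 2\<close>.\<close>
  have D_eq: "x * x = D + x + 2" by (simp add: D_def algebra_simps)
  have F': "2 * cos \<theta> * D = (x\<^sup>2 - 3) * D - 2"
  proof -
    have "2 * cos \<theta> = x\<^sup>2 - 3 - 2 / D" by (simp only: wgp_fun_def D_def flip: F)
    then show ?thesis using D by (simp add: field_simps)
  qed
  show ?thesis
  proof (rule wgp_eigenvectorI[OF _ _ _ _ _ u])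
    \<comment> \<open>The missing neighbours at the ends would carry \<open>sin 0\<close> and
      \<open>sin (real (k + 1) * \<theta>)\<close>, both zero.\<close>
    fix i assume "i \<le> k"
    then show "(if 0 < i then wgp_wave_vec \<theta> x (Vq (i - 1)) else 0)
        + (if i < k then wgp_wave_vec \<theta> x (Vq i) else 0) = x * wgp_wave_vec \<theta> x (Vp i)"
      using \<theta> x by (cases "i = k") (auto simp: of_nat_diff)
  next
    fix i
    let ?s = "\<lambda>l. sin (real l * \<theta>)"
    \<comment> \<open>The path recurrence, from the addition formulas for sine.\<close>
    have rec: "?s i + ?s (i + 2) = 2 * cos \<theta> * ?s (i + 1)"
    proof -
      have "sin (real (i + 1) * \<theta> - \<theta>) + sin (real (i + 1) * \<theta> + \<theta>) = 2 * cos \<theta> * ?s (i + 1)"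
        by (simp only: sin_add sin_diff) simp
      then show ?thesis by (simp add: algebra_simps)
    qed
    \<comment> \<open>This is the equation at \<open>Vq i\<close> multiplied by
      \<open>x * D\<close>: its two neighbours on the path together contribute the first bracket
      over \<open>x\<close>.\<close>
    have "(?s i + 2 * ?s (i + 1) + ?s (i + 2)) * D + x * (x - 1) * ?s (i + 1)
        = (?s i + ?s (i + 2)) * D + (2 * D + (x * x - x)) * ?s (i + 1)"
      by (simp add: algebra_simps)
    also have "\<dots> = (2 * cos \<theta> * D + 3 * D + 2) * ?s (i + 1)"
      by (simp only: rec D_eq) (simp add: algebra_simps)
    also have "\<dots> = x * x * ?s (i + 1) * D"
      by (simp only: F') (simp add: algebra_simps power2_eq_square)
    finally have "((?s i + 2 * ?s (i + 1) + ?s (i + 2)) * D + x * (x - 1) * ?s (i + 1)) / (x * D)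
        = x * ?s (i + 1)"
      using x D by simp
    moreover have "((?s i + 2 * ?s (i + 1) + ?s (i + 2)) * D + x * (x - 1) * ?s (i + 1)) / (x * D)
        = (?s i + ?s (i + 1)) / x + (?s (i + 1) + ?s (i + 2)) / x + (x - 1) * ?s (i + 1) / D"
      using x D by (simp add: field_simps)
    ultimately have "(?s i + ?s (i + 1)) / x + (?s (i + 1) + ?s (i + 2)) / x + (x - 1) * ?s (i + 1) / D
        = x * ?s (i + 1)"
      by simp
    then show "wgp_wave_vec \<theta> x (Vp i) + wgp_wave_vec \<theta> x (Vp (i + 1)) + wgp_wave_vec \<theta> x (Vr i)
        = x * wgp_wave_vec \<theta> x (Vq i)"
      by (simp add: D_def)
    have "x * ((x - 1) * ?s (i + 1) / D) = (x * x - x) * ?s (i + 1) / D"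
      by (simp add: algebra_simps)
    also have "\<dots> = (D + 2) * ?s (i + 1) / D" by (simp add: D_eq)
    also have "\<dots> = ?s (i + 1) + ?s (i + 1) / D + ?s (i + 1) / D"
      using D by (simp add: add_divide_distrib ring_distribs)
    finally have "?s (i + 1) + ?s (i + 1) / D + ?s (i + 1) / D = x * ((x - 1) * ?s (i + 1) / D)" ..
    then show "wgp_wave_vec \<theta> x (Vq i) + wgp_wave_vec \<theta> x (Vs i) + wgp_wave_vec \<theta> x (Vt i)
        = x * wgp_wave_vec \<theta> x (Vr i)"
      by (simp add: D_def)
    have "(x - 1) * ?s (i + 1) / D + ?s (i + 1) / D = x * (?s (i + 1) / D)"
      by (simp add: add_divide_distrib[symmetric] algebra_simps)
    then show "wgp_wave_vec \<theta> x (Vr i) + wgp_wave_vec \<theta> x (Vt i) = x * wgp_wave_vec \<theta> x (Vs i)"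
      "wgp_wave_vec \<theta> x (Vr i) + wgp_wave_vec \<theta> x (Vs i) = x * wgp_wave_vec \<theta> x (Vt i)"
      by (simp_all add: D_def)
  qed
qed

section \<open>Completeness of the eigenbasis and the energy sum\<close>

theorem theorem2:
  fixes k :: nat
  assumes "k \<ge> 1"
  shows "graph_energy (wine_glass_path k) =
    2 * real k
    - 2 * (\<Sum>j=1..k. wgp_alpha (2 * cos (real j * pi / (real k + 1))))
    - 2 * (\<Sum>j=1..k. wgp_beta (2 * cos (real j * pi / (real k + 1))))"
proof -
  let ?V = "pverts (wine_glass_path k)"
  define \<theta> where "\<theta> j = real j * pi / (real k + 1)" for j
  have \<theta>: "0 < \<theta> j" "\<theta> j < pi" if "j \<in> {1..k}" for j
    using that by (auto simp: \<theta>_def divide_simps)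
  \<comment> \<open>Hence the sets of roots belonging to different \<open>j\<close> will be
    disjoint.\<close>
  have cos_inj: "j = j'" if "j \<in> {1..k}" "j' \<in> {1..k}" "cos (\<theta> j) = cos (\<theta> j')" for j j'
  proof -
    have "\<theta> j = \<theta> j'"
      by (rule cos_inj_pi[OF less_imp_le less_imp_le less_imp_le less_imp_le that(3)])
        (intro \<theta> that)+
    then have "real j * pi = real j' * pi"
      unfolding \<theta>_def by (subst (asm) divide_cancel_right) linarith
    then show ?thesis by simp
  qed
  have "\<exists>R. card R = 4 \<and> (\<forall>x\<in>R. x \<noteq> -1 \<and> x \<noteq> 0 \<and> x \<noteq> 2 \<and> wgp_fun x = 2 * cos (\<theta> j))
    \<and> (\<Sum>x\<in>R. \<bar>x\<bar>) = 1 - 2 * wgp_alpha (2 * cos (\<theta> j)) - 2 * wgp_beta (2 * cos (\<theta> j))"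
    if "j \<in> {1..k}" for j
    \<comment> \<open>From \<open>\<theta> j < pi\<close> follows
      \<open>cos (\<theta> j) > -1\<close>, the strict bound that \<open>wgp_fun_roots\<close> asks
      for.\<close>
    using cos_monotone_0_pi[of "\<theta> j" pi] \<theta>[OF that] by (intro wgp_fun_roots) auto
  then obtain R where card_R: "\<And>j. j \<in> {1..k} \<Longrightarrow> card (R j) = 4"
    and R: "\<And>j x. j \<in> {1..k} \<Longrightarrow> x \<in> R j \<Longrightarrow> x \<noteq> -1 \<and> x \<noteq> 0 \<and> x \<noteq> 2 \<and> wgp_fun x = 2 * cos (\<theta> j)"
    and sum_R: "\<And>j. j \<in> {1..k} \<Longrightarrow> (\<Sum>x\<in>R j. \<bar>x\<bar>)
      = 1 - 2 * wgp_alpha (2 * cos (\<theta> j)) - 2 * wgp_beta (2 * cos (\<theta> j))"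
    by metis
  have fin_R: "finite (R j)" if "j \<in> {1..k}" for j
    using card_R[OF that] by (intro card_ge_0_finite) simp
  \<comment> \<open>An index pairs a label with its eigenvalue: \<open>(0, 0)\<close> for the null
    vector, \<open>B\<close> for the bowls, \<open>S\<close> for the waves. No \<open>R j\<close>
    contains 0 or -1, so \<open>f\<close> can tell the families apart by \<open>x\<close>. Bowls are
    numbered from 0 but labels from 1, hence \<open>j - 1\<close>.\<close>
  define S B where "S = Sigma {1..k} R" and "B = {1..k} \<times> {-1 :: real}"
  define I where "I = insert (0, 0) (B \<union> S)"
  define f where "f = (\<lambda>(j, x). if x = 0 then wgp_null_vec
    else if x = -1 then wgp_bowl_vec (j - 1) else wgp_wave_vec (\<theta> j) x)"
  have fin: "finite B" "finite S" using fin_R by (auto simp: B_def S_def)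
  have disj: "B \<inter> S = {}" "(0, 0) \<notin> B \<union> S" using R unfolding B_def S_def by (blast, auto)
  have "card S = 4 * k" using fin_R card_R by (simp add: S_def)
  \<comment> \<open>The count is \<open>1 + k + 4 * k\<close>, so no eigenvalue is missed.\<close>
  then have card_I: "card I = card ?V"
    using fin disj by (simp add: I_def card_Un_disjoint card_wine_glass_path) (simp add: B_def)
  have "graph_energy (wine_glass_path k) = (\<Sum>i\<in>I. \<bar>snd i\<bar>)"
  proof (rule graph_energy_eigenbasis[OF pair_graph_wine_glass_path _ card_I, of f])
    show "finite I" using fin by (simp add: I_def)
  next
    fix i u assume i: "i \<in> I" and u: "u \<in> ?V"
    obtain j x where jx: "i = (j, x)" by force
    consider "x = 0" | "x = -1" | "j \<in> {1..k}" "x \<in> R j"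
      using i by (auto simp: jx I_def B_def S_def)
    then show "(\<Sum>v | (u, v) \<in> parcs (wine_glass_path k). f i v) = snd i * f i u"
    proof cases
      case 3
      have "real (k + 1) * \<theta> j = real j * pi" by (simp add: \<theta>_def field_simps)
      then have "sin (real (k + 1) * \<theta> j) = 0" by simp
      then show ?thesis
        using wgp_wave_vec_eigen[OF _ _ _ _ _ u, of x "\<theta> j"] R[OF 3] by (simp add: f_def jx)
    qed (use wgp_null_vec_eigen[OF u] wgp_bowl_vec_eigen[OF u] in \<open>simp_all add: f_def jx\<close>)
  next
    fix i i' assume i: "i \<in> I" "i' \<in> I" "i \<noteq> i'" "snd i = snd i'"
    obtain j j' x where jx: "i = (j, x)" "i' = (j', x)" using i(4) by (cases i, cases i') auto
    \<comment> \<open>For \<open>x\<close> in both \<open>R j\<close> and \<open>R j'\<close>,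
      \<open>wgp_fun x\<close> determines the cosine and thus the label. Only bowl vectors share an
      eigenvalue, and their supports are disjoint.\<close>
    have "x = -1 \<and> j \<in> {1..k} \<and> j' \<in> {1..k}"
      using i R[of j x] R[of j' x] cos_inj[of j j'] by (auto simp: jx I_def B_def S_def)
    moreover from this have "wgp_bowl_vec (j - 1) v * wgp_bowl_vec (j' - 1) v = 0" for v
      using i(3) jx by (cases v) auto
    ultimately show "(\<Sum>v\<in>?V. f i v * f i' v) = 0" by (simp add: f_def jx)
  next
    fix i assume i: "i \<in> I"
    obtain j x where jx: "i = (j, x)" by force
    consider "x = 0" | "x = -1" "j \<in> {1..k}" | "j \<in> {1..k}" "x \<in> R j"
      using i by (auto simp: jx I_def B_def S_def)
    then show "\<exists>v\<in>?V. f i v \<noteq> 0"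
    proof cases
      case 1
      then show ?thesis by (intro bexI[of _ "Vp 0"]) (auto simp: f_def jx wine_glass_path_def)
    next
      case 2
      then show ?thesis by (intro bexI[of _ "Vs (j - 1)"]) (auto simp: f_def jx wine_glass_path_def)
    next
      case 3
      \<comment> \<open>A wave vector has the value \<open>sin (\<theta> j) > 0\<close> at
        \<open>Vq 0\<close>.\<close>
      then show ?thesis using R[OF 3] sin_gt_zero[OF \<theta>[OF 3(1)]] assms
        by (intro bexI[of _ "Vq 0"]) (auto simp: f_def jx wine_glass_path_def)
    qed
  qed
  also have "\<dots> = (\<Sum>i\<in>B. \<bar>snd i\<bar>) + (\<Sum>i\<in>S. \<bar>snd i\<bar>)"
    using fin disj by (simp add: I_def sum.union_disjoint)
  \<comment> \<open>The bowls contribute \<open>k\<close>; the constants 1 in \<open>sum_R\<close>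
    contribute the other \<open>k\<close> of the leading term.\<close>
  also have "(\<Sum>i\<in>B. \<bar>snd i\<bar>) = real k"
    by (simp add: B_def sum.cartesian_product')
  also have "(\<Sum>i\<in>S. \<bar>snd i\<bar>) = (\<Sum>j=1..k. \<Sum>x\<in>R j. \<bar>x\<bar>)"
    using fin_R by (simp add: S_def sum.Sigma split_def)
  also have "\<dots> = (\<Sum>j=1..k. 1 - 2 * wgp_alpha (2 * cos (\<theta> j)) - 2 * wgp_beta (2 * cos (\<theta> j)))"
    using sum_R by (intro sum.cong) auto
  finally show ?thesis
    by (simp add: sum_subtractf sum_distrib_left \<theta>_def)
qed

end
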